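(* Let $C\subseteq\mathbb{R}^n$ be a nonempty convex compact set, let $f:C\times C\to\mathbb{R}$ satisfy $f(x,x)=0$ for all $x\in C$, and let $K:C\rightrightarrows C$ be a set-valued map. Define $F:C\rightrightarrows C$ by $F(x):=\{y\in C: f(x,y)<0\}$. Assume that $K$ is lower semicontinuous with nonempty convex values and that $\operatorname{fix}K$ is closed. Moreover suppose that (i) $F(x)$ is convex for every $x\in\operatorname{fix}K$; (ii) $F$ is lower semicontinuous on $\operatorname{fix}K$; (iii) the map $F\cap K: x\mapsto F(x)\cap K(x)$ is lower semicontinuous on $\partial_C\operatorname{fix}K$. Then there exists a solution of the quasiequilibrium problem (that is, a point $x\in K(x)$ with $f(x,y)\ge 0$ for all $y\in K(x)$) that belongs to the set $$\partial_C\operatorname{fix}K\ \cup\ \{x\in\operatorname{int}_C\operatorname{fix}K:\ f(x,y)\ge 0\ \text{for all } y\in C\}.$$ In particular, if there is no $x\in C$ such that $f(x,y)\ge 0$ for all $y\in C$, then a solution of the quasiequilibrium problem lies in $\partial_C\operatorname{fix}K$.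
   Context: A set-valued map $\Phi:X\rightrightarrows Y$ between topological spaces assigns to each $x\in X$ a (possibly empty) subset $\Phi(x)\subseteq Y$. It is lower semicontinuous at $x$ if for each open set $\Omega$ with $\Phi(x)\cap\Omega\neq\emptyset$ there is a neighborhood $U_x$ of $x$ such that $\Phi(x')\cap\Omega\neq\emptyset$ for all $x'\in U_x$; it is lower semicontinuous if it is so at every point. "Lower semicontinuous on $S$", for $S\subseteq X$, means that the restriction of the map to $S$ (with the relative topology on $S$) is lower semicontinuous. $\operatorname{fix}K:=\{x\in C: x\in K(x)\}$. For $A\subseteq C$, $\operatorname{int}_CA$ and $\operatorname{cl}_CA$ are the interior and closure of $A$ in the relative topology of $C$, and $\partial_CA:=\operatorname{cl}_CA\setminus\operatorname{int}_CA$. *)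

theory Defs
  imports "HOL-Analysis.Analysis"
begin

text \<open>
  A set-valued map between topological spaces \<open>X\<close> and \<open>Y\<close> is a function into sets, of which only
  the values at points of \<open>topspace X\<close> matter.
\<close>

definition lower_semicontinuous_at ::
  "'a topology \<Rightarrow> 'b topology \<Rightarrow> ('a \<Rightarrow> 'b set) \<Rightarrow> 'a \<Rightarrow> bool" where
  "lower_semicontinuous_at X Y \<Phi> x \<longleftrightarrow>
     (\<forall>\<Omega>. openin Y \<Omega> \<and> \<Phi> x \<inter> \<Omega> \<noteq> {} \<longrightarrow>
        (\<exists>U. openin X U \<and> x \<in> U \<and> (\<forall>x'\<in>U. \<Phi> x' \<inter> \<Omega> \<noteq> {})))"

definition lower_semicontinuous_map ::
  "'a topology \<Rightarrow> 'b topology \<Rightarrow> ('a \<Rightarrow> 'b set) \<Rightarrow> bool" where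
  "lower_semicontinuous_map X Y \<Phi> \<longleftrightarrow> (\<forall>x\<in>topspace X. lower_semicontinuous_at X Y \<Phi> x)"

definition lower_semicontinuous_map_on ::
  "'a topology \<Rightarrow> 'b topology \<Rightarrow> 'a set \<Rightarrow> ('a \<Rightarrow> 'b set) \<Rightarrow> bool" where
  "lower_semicontinuous_map_on X Y S \<Phi> \<longleftrightarrow> lower_semicontinuous_map (subtopology X S) Y \<Phi>"

definition fixed_set :: "'a set \<Rightarrow> ('a \<Rightarrow> 'a set) \<Rightarrow> 'a set" where
  "fixed_set C K = {x \<in> C. x \<in> K x}"

definition strict_sublevel :: "'a set \<Rightarrow> ('a \<Rightarrow> 'a \<Rightarrow> real) \<Rightarrow> 'a \<Rightarrow> 'a set" where
  "strict_sublevel C f x = {y \<in> C. f x y < 0}"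

definition quasiequilibrium_solution ::
  "'a set \<Rightarrow> ('a \<Rightarrow> 'a \<Rightarrow> real) \<Rightarrow> ('a \<Rightarrow> 'a set) \<Rightarrow> 'a \<Rightarrow> bool" where
  "quasiequilibrium_solution C f K x \<longleftrightarrow> x \<in> C \<and> x \<in> K x \<and> (\<forall>y\<in>K x. f x y \<ge> 0)"

end

(* Suppose there is no solution of the required kind, and put G = K outside fix K, G = F on the
   relative interior of fix K and G = F \<inter> K on its relative boundary. Then G is lower semicontinuous
   with nonempty convex values and has no fixed point. This is impossible in finite dimension, even
   though the values of G need not be closed: Michael's selection theorem yields countably many
   continuous selections of the closure of G that are dense in each value, and their weighted mean
   with weights 2^{-i-1} lies in the relative interior of G(x), hence in G(x); Brouwer's theorem
   applies to it. *)

theory Submission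
  imports Defs
begin

section \<open>Lower semicontinuous maps: lower preimages, gluing, intersection with balls\<close>

lemma lower_semicontinuous_map_iff_openin:
  "lower_semicontinuous_map X Y \<Phi> \<longleftrightarrow>
     (\<forall>T. openin Y T \<longrightarrow> openin X {x \<in> topspace X. \<Phi> x \<inter> T \<noteq> {}})"  (is "?lsc \<longleftrightarrow> ?op")
proof
  assume ?lsc
  show ?op
  proof (intro allI impI)
    fix T assume T: "openin Y T"
    let ?V = "{x \<in> topspace X. \<Phi> x \<inter> T \<noteq> {}}"
    have "\<exists>U. openin X U \<and> x \<in> U \<and> U \<subseteq> ?V" if x: "x \<in> ?V" for x
    proof -
      have "lower_semicontinuous_at X Y \<Phi> x"
        using \<open>?lsc\<close> x by (simp add: lower_semicontinuous_map_def)
      then obtain U where U: "openin X U" "x \<in> U" "\<forall>x'\<in>U. \<Phi> x' \<inter> T \<noteq> {}"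
        unfolding lower_semicontinuous_at_def using T x by blast
      then have "U \<subseteq> ?V"
        using openin_subset[OF U(1)] by auto
      then show ?thesis using U by blast
    qed
    then show "openin X ?V"
      by (subst openin_subopen) blast
  qed
next
  assume op: ?op
  show ?lsc
    unfolding lower_semicontinuous_map_def lower_semicontinuous_at_def
  proof (intro ballI allI impI)
    fix x T assume "x \<in> topspace X" and T: "openin Y T \<and> \<Phi> x \<inter> T \<noteq> {}"
    then show "\<exists>U. openin X U \<and> x \<in> U \<and> (\<forall>x'\<in>U. \<Phi> x' \<inter> T \<noteq> {})"
      using op by (intro exI[of _ "{x \<in> topspace X. \<Phi> x \<inter> T \<noteq> {}}"]) simp
  qed
qed

lemma lower_semicontinuous_map_subtopology:
  assumes "lower_semicontinuous_map X Y \<Phi>"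
  shows "lower_semicontinuous_map (subtopology X S) Y \<Phi>"
  unfolding lower_semicontinuous_map_iff_openin
proof (intro allI impI)
  fix T assume "openin Y T"
  then have "openin X {x \<in> topspace X. \<Phi> x \<inter> T \<noteq> {}}"
    using assms by (simp add: lower_semicontinuous_map_iff_openin)
  moreover have "{x \<in> topspace (subtopology X S). \<Phi> x \<inter> T \<noteq> {}} =
      {x \<in> topspace X. \<Phi> x \<inter> T \<noteq> {}} \<inter> S"
    by auto
  ultimately show "openin (subtopology X S) {x \<in> topspace (subtopology X S). \<Phi> x \<inter> T \<noteq> {}}"
    unfolding openin_subtopology by blast
qed

text \<open>Only a frontier point of \<open>A\<close> sees both maps. There a point of
  \<open>\<Psi> x\<close> in an open set is also a point of \<open>\<Phi> x\<close>, so nearby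
  points on either side of the frontier keep meeting that set.\<close>

lemma lower_semicontinuous_map_glue:
  assumes A: "closedin X A"
    and \<Phi>: "lower_semicontinuous_map X Y \<Phi>"
    and \<Psi>: "lower_semicontinuous_map (subtopology X A) Y \<Psi>"
    and sub: "\<And>x. x \<in> X frontier_of A \<Longrightarrow> \<Psi> x \<subseteq> \<Phi> x"
  shows "lower_semicontinuous_map X Y (\<lambda>x. if x \<in> A then \<Psi> x else \<Phi> x)"
  unfolding lower_semicontinuous_map_iff_openin
proof (intro allI impI)
  fix T assume T: "openin Y T"
  have AX: "A \<subseteq> topspace X"
    using A closedin_subset by blast
  have "openin (subtopology X A) {x \<in> A. \<Psi> x \<inter> T \<noteq> {}}"
    using \<Psi> T AX by (simp add: lower_semicontinuous_map_iff_openin inf.absorb2)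
  then obtain W where W: "openin X W" "{x \<in> A. \<Psi> x \<inter> T \<noteq> {}} = W \<inter> A"
    by (auto simp: openin_subtopology)
  have P: "openin X {x \<in> topspace X. \<Phi> x \<inter> T \<noteq> {}}"
    using \<Phi> T by (simp add: lower_semicontinuous_map_iff_openin)
  have fr: "X frontier_of A = A - X interior_of A"
    using A by (simp add: frontier_of_def closure_of_closedin)
  have int: "X interior_of A \<subseteq> A"
    by (rule interior_of_subset)
  have memW: "\<Psi> x \<inter> T \<noteq> {} \<longleftrightarrow> x \<in> W" if "x \<in> A" for x
    using W(2) that by blast
  \<comment> \<open>Three cases: in the interior of \<open>A\<close> the open set \<open>W\<close>
    decides; outside \<open>A\<close>, which is open since \<open>A\<close> is closed,
    \<open>\<Phi>\<close> decides; at a frontier point \<open>x \<in> W\<close> already forces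
    \<open>\<Phi> x\<close> to meet \<open>T\<close>, by \<open>sub\<close>. So the preimage is a
    union of open sets.\<close>
  have "{x \<in> topspace X. (if x \<in> A then \<Psi> x else \<Phi> x) \<inter> T \<noteq> {}} =
      (X interior_of A \<inter> W) \<union>
      ({x \<in> topspace X. \<Phi> x \<inter> T \<noteq> {}} \<inter> ((topspace X - A) \<union> W))"  (is "?L = ?R")
  proof (rule set_eqI)
    fix x
    show "x \<in> ?L \<longleftrightarrow> x \<in> ?R"
    proof (cases "x \<in> A")
      case True
      then have "\<Psi> x \<inter> T \<noteq> {} \<Longrightarrow> x \<notin> X interior_of A \<Longrightarrow> \<Phi> x \<inter> T \<noteq> {}"
        using sub[of x] fr by blast
      then show ?thesis
        using True AX memW[OF True] by (simp add: subset_iff) blast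
    next
      case False
      then have "x \<notin> X interior_of A" using int by blast
      then show ?thesis using False by auto
    qed
  qed
  moreover have "openin X ?R"
    using W(1) P A by (intro openin_Un openin_Int openin_interior_of openin_diff openin_topspace)
  ultimately show "openin X {x \<in> topspace X. (if x \<in> A then \<Psi> x else \<Phi> x) \<inter> T \<noteq> {}}"
    by simp
qed

text \<open>The ball is open, so a point inside it has positive slack, which absorbs a small move of
  both the centre and the point. Closed balls would not do.\<close>

lemma lower_semicontinuous_map_Int_ball:
  fixes g :: "'a::topological_space \<Rightarrow> 'b::metric_space"
  assumes \<Phi>: "lower_semicontinuous_map (top_of_set S) euclidean \<Phi>" and g: "continuous_on S g"
  shows "lower_semicontinuous_map (top_of_set S) euclidean (\<lambda>x. \<Phi> x \<inter> ball (g x) e)"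
  unfolding lower_semicontinuous_map_def lower_semicontinuous_at_def
proof (intro ballI allI impI)
  fix x \<Omega> assume x: "x \<in> topspace (top_of_set S)"
    and "openin euclidean \<Omega> \<and> \<Phi> x \<inter> ball (g x) e \<inter> \<Omega> \<noteq> {}"
  then obtain y where y: "open \<Omega>" "y \<in> \<Phi> x" "dist (g x) y < e" "y \<in> \<Omega>"
    by auto
  \<comment> \<open>Half of the slack goes to the move of the centre from \<open>g x\<close> to
    \<open>g x'\<close>, half to the move from \<open>y\<close> to a point of
    \<open>\<Phi> x'\<close>.\<close>
  define d where "d = (e - dist (g x) y) / 2"
  have d: "d > 0" using y by (simp add: d_def)
  define U where "U = {x' \<in> S. \<Phi> x' \<inter> (\<Omega> \<inter> ball y d) \<noteq> {}} \<inter> (S \<inter> g -` ball (g x) d)"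
  have "openin (top_of_set S) {x' \<in> topspace (top_of_set S). \<Phi> x' \<inter> (\<Omega> \<inter> ball y d) \<noteq> {}}"
    using \<Phi> y unfolding lower_semicontinuous_map_iff_openin by (simp add: open_Int)
  moreover have "openin (top_of_set S) (S \<inter> g -` ball (g x) d)"
    using g by (simp add: continuous_openin_preimage_gen)
  ultimately have "openin (top_of_set S) U"
    unfolding U_def by (simp add: openin_Int)
  moreover have "x \<in> U"
    using x y d by (auto simp: U_def)
  moreover have "\<Phi> x' \<inter> ball (g x') e \<inter> \<Omega> \<noteq> {}" if "x' \<in> U" for x'
  proof -
    obtain z where z: "z \<in> \<Phi> x'" "z \<in> \<Omega>" "dist y z < d" "dist (g x) (g x') < d"
      using \<open>x' \<in> U\<close> by (auto simp: U_def)
    have "dist (g x') z \<le> dist (g x) (g x') + dist (g x) y + dist y z"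
      by metric
    then have "dist (g x') z < e"
      using z by (simp add: d_def)
    then show ?thesis
      using z by auto
  qed
  ultimately show "\<exists>U. openin (top_of_set S) U \<and> x \<in> U \<and> (\<forall>x'\<in>U. \<Phi> x' \<inter> ball (g x') e \<inter> \<Omega> \<noteq> {})"
    by blast
qed

section \<open>Michael's selection theorem\<close>

text \<open>Locally a constant \<open>y\<close> is \<open>e\<close>-close to the values, by lower
  semicontinuity. A partition of unity averages these constants, and convexity of the values keeps
  the average \<open>e\<close>-close.\<close>

lemma approximate_selection:
  fixes \<Phi> :: "'a::{metric_space,second_countable_topology} \<Rightarrow> 'b::real_normed_vector set"
  assumes lsc: "lower_semicontinuous_map (top_of_set S) euclidean \<Phi>"
    and ne: "\<And>x. x \<in> S \<Longrightarrow> \<Phi> x \<noteq> {}" and conv: "\<And>x. x \<in> S \<Longrightarrow> convex (\<Phi> x)" and "e > 0"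
  obtains g where "continuous_on S g" "\<And>x. x \<in> S \<Longrightarrow> \<Phi> x \<inter> ball (g x) e \<noteq> {}"
proof -
  define \<B> where "\<B> = {T. open T \<and> (\<exists>y. \<forall>x\<in>S \<inter> T. \<Phi> x \<inter> ball y e \<noteq> {})}"
  have "S \<subseteq> \<Union>\<B>"
  proof
    fix x assume "x \<in> S"
    then obtain y where y: "y \<in> \<Phi> x" using ne by blast
    have "openin (top_of_set S) {x \<in> topspace (top_of_set S). \<Phi> x \<inter> ball y e \<noteq> {}}"
      using lsc unfolding lower_semicontinuous_map_iff_openin by simp
    then obtain T where T: "open T" "{x \<in> S. \<Phi> x \<inter> ball y e \<noteq> {}} = S \<inter> T"
      by (auto simp: openin_open)
    then have "T \<in> \<B>" by (auto simp: \<B>_def)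
    moreover have "x \<in> {x \<in> S. \<Phi> x \<inter> ball y e \<noteq> {}}"
      using \<open>x \<in> S\<close> y \<open>e > 0\<close> by auto
    ultimately show "x \<in> \<Union>\<B>" using T by blast
  qed
  then obtain \<C> where cov: "S \<subseteq> \<Union>\<C>"
    and \<C>: "\<And>U. U \<in> \<C> \<Longrightarrow> open U \<and> (\<exists>T. T \<in> \<B> \<and> U \<subseteq> T)"
    and fin: "\<And>x. x \<in> S \<Longrightarrow> \<exists>V. open V \<and> x \<in> V \<and> finite {U. U \<in> \<C> \<and> U \<inter> V \<noteq> {}}"
    by (rule paracompact) (auto simp: \<B>_def)
  have "\<forall>U\<in>\<C>. \<exists>y. \<forall>x\<in>S \<inter> U. \<Phi> x \<inter> ball y e \<noteq> {}"
    using \<C> by (fastforce simp: \<B>_def)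
  then obtain y where y: "\<And>U x. \<lbrakk>U \<in> \<C>; x \<in> S; x \<in> U\<rbrakk> \<Longrightarrow> \<Phi> x \<inter> ball (y U) e \<noteq> {}"
    by (metis IntI)
  obtain F :: "'a set \<Rightarrow> 'a \<Rightarrow> real" where
      F: "\<And>U. U \<in> \<C> \<Longrightarrow> continuous_on S (F U) \<and> (\<forall>x \<in> S. 0 \<le> F U x)"
    and F0: "\<And>x U. \<lbrakk>U \<in> \<C>; x \<in> S; x \<notin> U\<rbrakk> \<Longrightarrow> F U x = 0"
    and F1: "\<And>x. x \<in> S \<Longrightarrow> supp_sum (\<lambda>W. F W x) \<C> = 1"
    and Ffin: "\<And>x. x \<in> S \<Longrightarrow> \<exists>V. open V \<and> x \<in> V \<and> finite {U \<in> \<C>. \<exists>x\<in>V. F U x \<noteq> 0}"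
    by (rule subordinate_partition_of_unity[OF cov _ fin]) (use \<C> in auto)
  define g where "g x = supp_sum (\<lambda>U. F U x *\<^sub>R y U) \<C>" for x
  show thesis
  proof
    show "continuous_on S g"
      unfolding continuous_on_eq_continuous_within
    proof
      fix a assume "a \<in> S"
      then obtain V where V: "open V" "a \<in> V" and finV: "finite {U \<in> \<C>. \<exists>x\<in>V. F U x \<noteq> 0}"
        using Ffin by blast
      \<comment> \<open>Near \<open>a\<close> only the finitely many functions that are nonzero
        somewhere on \<open>V\<close> contribute, so \<open>g\<close> agrees there with a finite
        sum.\<close>
      show "continuous (at a within S) g"
      proof (rule continuous_transform_within_openin)
        show "continuous (at a within S) (\<lambda>x. \<Sum>U\<in>{U \<in> \<C>. \<exists>x\<in>V. F U x \<noteq> 0}. F U x *\<^sub>R y U)"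
          using F \<open>a \<in> S\<close> by (intro continuous_intros) (auto simp: continuous_on_eq_continuous_within)
        show "openin (top_of_set S) (S \<inter> V)" "a \<in> S \<inter> V"
          using V \<open>a \<in> S\<close> by auto
        show "(\<Sum>U\<in>{U \<in> \<C>. \<exists>x\<in>V. F U x \<noteq> 0}. F U x *\<^sub>R y U) = g x" if "x \<in> S \<inter> V" for x
          using that unfolding g_def supp_sum_def support_on_def
          by (intro sum.mono_neutral_right[OF finV]) auto
      qed
    qed
  next
    fix x assume x: "x \<in> S"
    \<comment> \<open>This Minkowski sum is the \<open>e\<close>-neighbourhood of
      \<open>\<Phi> x\<close>. It is convex and contains every \<open>y U\<close> that carries
      positive weight at \<open>x\<close>.\<close>
    have "g x \<in> (\<Union>z\<in>\<Phi> x. \<Union>w\<in>ball 0 e. {z + w})"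
      unfolding g_def
    proof (rule convex_supp_sum)
      show "convex (\<Union>z\<in>\<Phi> x. \<Union>w\<in>ball 0 e. {z + w})"
        using conv[OF x] by (intro convex_sums) auto
      show "supp_sum (\<lambda>U. F U x) \<C> = 1" by (rule F1[OF x])
      fix U assume U: "U \<in> \<C>"
      have "y U \<in> (\<Union>z\<in>\<Phi> x. \<Union>w\<in>ball 0 e. {z + w})" if xU: "x \<in> U"
      proof -
        obtain z where "z \<in> \<Phi> x" "dist (y U) z < e" using y[OF U x xU] by auto
        then have "y U - z \<in> ball 0 e" "y U = z + (y U - z)"
          by (auto simp: dist_norm norm_minus_commute)
        then show ?thesis
          using \<open>z \<in> \<Phi> x\<close> by blast
      qed
      then show "0 \<le> F U x \<and> (F U x = 0 \<or> y U \<in> (\<Union>z\<in>\<Phi> x. \<Union>w\<in>ball 0 e. {z + w}))"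
        using F[OF U] F0[OF U x] x by blast
    qed
    then show "\<Phi> x \<inter> ball (g x) e \<noteq> {}"
      by (auto simp: dist_norm)
  qed
qed

text \<open>Approximate selections with errors \<open>r n\<close> are refined one after another so
  that they converge uniformly. The limit is approached by points of \<open>\<Phi> x\<close>, hence
  the closure.\<close>

theorem continuous_selection_closure:
  fixes \<Phi> :: "'a::{metric_space,second_countable_topology} \<Rightarrow> 'b::banach set"
  assumes lsc: "lower_semicontinuous_map (top_of_set S) euclidean \<Phi>"
    and ne: "\<And>x. x \<in> S \<Longrightarrow> \<Phi> x \<noteq> {}" and conv: "\<And>x. x \<in> S \<Longrightarrow> convex (\<Phi> x)"
  obtains g where "continuous_on S g" "\<And>x. x \<in> S \<Longrightarrow> g x \<in> closure (\<Phi> x)"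
proof -
  define r :: "nat \<Rightarrow> real" where "r n = (1/2) ^ n" for n
  have r: "r n > 0" "r (Suc n) \<le> r n" for n by (auto simp: r_def)
  have "\<exists>g. \<forall>n. (continuous_on S (g n) \<and> (\<forall>x\<in>S. \<Phi> x \<inter> ball (g n x) (r n) \<noteq> {})) \<and>
           (\<forall>x\<in>S. dist (g n x) (g (Suc n) x) < 2 * r n)"
  proof (rule dependent_nat_choice)
    show "\<exists>g. continuous_on S g \<and> (\<forall>x\<in>S. \<Phi> x \<inter> ball (g x) (r 0) \<noteq> {})"
      using approximate_selection[OF lsc ne conv r(1)] by metis
  next
    fix g n assume g: "continuous_on S g \<and> (\<forall>x\<in>S. \<Phi> x \<inter> ball (g x) (r n) \<noteq> {})"
    have lsc': "lower_semicontinuous_map (top_of_set S) euclidean (\<lambda>x. \<Phi> x \<inter> ball (g x) (r n))"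
      using lsc g by (intro lower_semicontinuous_map_Int_ball) auto
    have ne': "\<Phi> x \<inter> ball (g x) (r n) \<noteq> {}" and conv': "convex (\<Phi> x \<inter> ball (g x) (r n))"
      if "x \<in> S" for x
      using g that conv[OF that] by (auto intro!: convex_Int)
    \<comment> \<open>Approximating the truncated map instead of \<open>\<Phi>\<close> yields a
      point of \<open>\<Phi> x\<close> close to both \<open>g x\<close> and \<open>g' x\<close>:
      this gives the new approximation and bounds the step by
      \<open>r n + r (Suc n)\<close>.\<close>
    obtain g' where g': "continuous_on S g'"
      "\<And>x. x \<in> S \<Longrightarrow> \<Phi> x \<inter> ball (g x) (r n) \<inter> ball (g' x) (r (Suc n)) \<noteq> {}"
      using approximate_selection[OF lsc' ne' conv' r(1)] by metis
    have "dist (g x) (g' x) < 2 * r n" if x: "x \<in> S" for x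
    proof -
      obtain z where "dist (g x) z < r n" "dist (g' x) z < r (Suc n)"
        using g'(2)[OF x] by auto
      then show ?thesis
        using r(2)[of n] by metric
    qed
    then show "\<exists>g'. (continuous_on S g' \<and> (\<forall>x\<in>S. \<Phi> x \<inter> ball (g' x) (r (Suc n)) \<noteq> {})) \<and>
                (\<forall>x\<in>S. dist (g x) (g' x) < 2 * r n)"
      using g' by blast
  qed
  then obtain g where cont: "\<And>n. continuous_on S (g n)"
    and near: "\<And>n x. x \<in> S \<Longrightarrow> \<Phi> x \<inter> ball (g n x) (r n) \<noteq> {}"
    and step: "\<And>n x. x \<in> S \<Longrightarrow> dist (g n x) (g (Suc n) x) < 2 * r n"
    by metis
  \<comment> \<open>The limit is written as a telescoping series, so that the M-test with the bounds
    \<open>2 * r n\<close> gives uniform convergence.\<close>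
  define l where "l x = g 0 x + (\<Sum>n. g (Suc n) x - g n x)" for x
  have "uniform_limit S (\<lambda>n x. \<Sum>i<n. g (Suc i) x - g i x) (\<lambda>x. \<Sum>n. g (Suc n) x - g n x) sequentially"
  proof (rule Weierstrass_m_test)
    show "norm (g (Suc n) x - g n x) \<le> 2 * r n" if "x \<in> S" for n x
      using step[OF that, of n] by (simp add: dist_norm norm_minus_commute)
    show "summable (\<lambda>n. 2 * r n)"
      unfolding r_def by (intro summable_mult summable_geometric) auto
  qed
  then have "uniform_limit S (\<lambda>n x. g 0 x + (\<Sum>i<n. g (Suc i) x - g i x)) l sequentially"
    unfolding l_def by (intro uniform_limit_intros)
  moreover have "(\<lambda>n x. g 0 x + (\<Sum>i<n. g (Suc i) x - g i x)) = g"
    using sum_lessThan_telescope[of "\<lambda>n. g n x" for x] by (simp add: fun_eq_iff)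
  ultimately have lim: "uniform_limit S g l sequentially"
    by simp
  show thesis
  proof
    show "continuous_on S l"
      by (rule uniform_limit_theorem[OF _ lim]) (auto simp: cont)
  next
    fix x assume x: "x \<in> S"
    have "\<forall>n. \<exists>y. y \<in> \<Phi> x \<and> dist (g n x) y < r n"
      using near[OF x] by fastforce
    then obtain y where y: "\<And>n. y n \<in> \<Phi> x" "\<And>n. dist (g n x) (y n) < r n"
      by metis
    have "r \<longlonglongrightarrow> 0"
      unfolding r_def by (rule LIMSEQ_power_zero) auto
    then have "(\<lambda>n. y n - g n x) \<longlonglongrightarrow> 0"
      by (rule Lim_null_comparison[rotated])
        (use y(2) in \<open>auto intro!: always_eventually less_imp_le simp: dist_norm norm_minus_commute\<close>)
    moreover have "(\<lambda>n. g n x) \<longlonglongrightarrow> l x"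
      using tendsto_uniform_limitI[OF lim x] .
    ultimately have "(\<lambda>n. (y n - g n x) + g n x) \<longlonglongrightarrow> 0 + l x"
      by (rule tendsto_add)
    then show "l x \<in> closure (\<Phi> x)"
      using y(1) unfolding closure_sequential by auto
  qed
qed

section \<open>Dense families of selections and their weighted means\<close>

text \<open>For each small ball with centre in a countable dense set, selections are wanted that lie
  in its closure wherever \<open>\<Phi> x\<close> meets the ball. The set of such \<open>x\<close>
  is relatively open while gluing needs a closed set, so it is exhausted by countably many closed
  pieces, with one selection for each.\<close>

lemma dense_continuous_selections:
  fixes \<Phi> :: "'a::{metric_space,second_countable_topology} \<Rightarrow> 'b::{banach,second_countable_topology} set"
  assumes lsc: "lower_semicontinuous_map (top_of_set S) euclidean \<Phi>"
    and ne: "\<And>x. x \<in> S \<Longrightarrow> \<Phi> x \<noteq> {}" and conv: "\<And>x. x \<in> S \<Longrightarrow> convex (\<Phi> x)"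
  shows "\<exists>g :: nat \<Rightarrow> 'a \<Rightarrow> 'b. (\<forall>i. continuous_on S (g i)) \<and>
    (\<forall>x\<in>S. (\<forall>i. g i x \<in> closure (\<Phi> x)) \<and> \<Phi> x \<subseteq> closure (range (\<lambda>i. g i x)))"
proof -
  obtain D :: "'b set" where D: "countable D" "\<And>X. open X \<Longrightarrow> X \<noteq> {} \<Longrightarrow> \<exists>d\<in>D. d \<in> X"
    by (metis countable_dense_setE)
  have "D \<noteq> {}" using D(2)[of UNIV] by auto
  define B where "B d m = ball d (1 / real (Suc m))" for d :: 'b and m
  define P where "P d m A \<longleftrightarrow> (\<forall>n::nat. closedin (top_of_set S) (A n)) \<and>
      \<Union>(range A) = {x \<in> S. \<Phi> x \<inter> B d m \<noteq> {}}" for d m A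
  have "\<exists>A. P d m A" for d m
  proof -
    have "openin (top_of_set S) {x \<in> topspace (top_of_set S). \<Phi> x \<inter> B d m \<noteq> {}}"
      using lsc unfolding lower_semicontinuous_map_iff_openin B_def by simp
    \<comment> \<open>Open sets of a metrizable space are countable unions of closed sets.\<close>
    then have "fsigma_in (top_of_set S) {x \<in> S. \<Phi> x \<inter> B d m \<noteq> {}}"
      using open_imp_fsigma_in[OF metrizable_space_subtopology[OF metrizable_space_euclidean]] by simp
    then show ?thesis
      unfolding fsigma_in_ascending P_def by blast
  qed
  then obtain A where "\<And>d m. P d m (A d m)"
    by metis
  then have A: "closedin (top_of_set S) (A d m n)"
    "\<Union>(range (A d m)) = {x \<in> S. \<Phi> x \<inter> B d m \<noteq> {}}" for d m n
    unfolding P_def by blast+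
  define Q where "Q d m n g \<longleftrightarrow> continuous_on S g \<and> (\<forall>x\<in>S. g x \<in> closure (\<Phi> x)) \<and>
      (\<forall>x\<in>A d m n. g x \<in> closure (B d m))" for d m n g
  have "\<exists>g. Q d m n g" for d m n
  proof -
    \<comment> \<open>Shrinking the values to the ball on the closed piece forces a selection into
      the closed ball there; the gluing condition holds because the new values are subsets of the
      old ones.\<close>
    define \<Psi> where "\<Psi> x = (if x \<in> A d m n then \<Phi> x \<inter> B d m else \<Phi> x)" for x
    have AS: "A d m n \<subseteq> {x \<in> S. \<Phi> x \<inter> B d m \<noteq> {}}"
      using A(2) by blast
    have "lower_semicontinuous_map (top_of_set S) euclidean (\<lambda>x. \<Phi> x \<inter> B d m)"
      unfolding B_def by (intro lower_semicontinuous_map_Int_ball lsc continuous_on_const)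
    then have "lower_semicontinuous_map (top_of_set S) euclidean \<Psi>"
      unfolding \<Psi>_def
      by (intro lower_semicontinuous_map_glue[OF A(1) lsc lower_semicontinuous_map_subtopology]) auto
    moreover have "\<Psi> x \<noteq> {}" "convex (\<Psi> x)" if "x \<in> S" for x
      using that AS ne conv by (auto simp: \<Psi>_def B_def convex_Int)
    ultimately obtain g where g: "continuous_on S g" "\<And>x. x \<in> S \<Longrightarrow> g x \<in> closure (\<Psi> x)"
      using continuous_selection_closure by blast
    have "g x \<in> closure (\<Phi> x)" if "x \<in> S" for x
      using g(2)[OF that] closure_mono[of "\<Psi> x" "\<Phi> x"] by (auto simp: \<Psi>_def split: if_splits)
    moreover have "g x \<in> closure (B d m)" if "x \<in> A d m n" for x
      using g(2)[of x] closure_mono[of "\<Psi> x" "B d m"] that AS by (auto simp: \<Psi>_def)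
    ultimately show ?thesis using g(1) unfolding Q_def by blast
  qed
  then obtain G where "\<And>d m n. Q d m n (G d m n)"
    by metis
  then have G: "continuous_on S (G d m n)"
    "x \<in> S \<Longrightarrow> G d m n x \<in> closure (\<Phi> x)"
    "x \<in> A d m n \<Longrightarrow> G d m n x \<in> closure (B d m)" for d m n x
    unfolding Q_def by blast+
  define I where "I = D \<times> (UNIV :: nat set) \<times> (UNIV :: nat set)"
  have I: "countable I" "I \<noteq> {}" using D(1) \<open>D \<noteq> {}\<close> by (auto simp: I_def)
  \<comment> \<open>The triples are enumerated by a single natural number, the index that later
    carries the weight \<open>(1/2) ^ Suc i\<close>.\<close>
  define g where "g i = (case from_nat_into I i of (d, m, n) \<Rightarrow> G d m n)" for i
  show ?thesis
  proof (intro exI[of _ g] conjI allI ballI)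
    show "continuous_on S (g i)" for i
      using G(1) by (simp add: g_def split: prod.split)
    show "g i x \<in> closure (\<Phi> x)" if "x \<in> S" for i x
      using G(2)[OF that] by (simp add: g_def split: prod.split)
  next
    fix x assume x: "x \<in> S"
    show "\<Phi> x \<subseteq> closure (range (\<lambda>i. g i x))"
    proof
      fix y assume y: "y \<in> \<Phi> x"
      show "y \<in> closure (range (\<lambda>i. g i x))"
        unfolding closure_approachable
      proof (intro allI impI)
        fix e :: real assume "e > 0"
        \<comment> \<open>Both \<open>y\<close> and the selection at \<open>x\<close> lie within
          \<open>1 / real (Suc m)\<close> of the centre \<open>d\<close>, hence the bound
          \<open>e / 2\<close>.\<close>
        then obtain m where m: "1 / real (Suc m) < e / 2"
          using nat_approx_posE[of "e/2"] by auto
        obtain d where d: "d \<in> D" "d \<in> ball y (1 / real (Suc m))"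
          using D(2)[of "ball y (1 / real (Suc m))"] by auto
        then have "x \<in> {x \<in> S. \<Phi> x \<inter> B d m \<noteq> {}}"
          using x y by (auto simp: B_def dist_commute)
        then obtain n where "x \<in> A d m n" using A(2)[of d m] by blast
        then have "G d m n x \<in> cball d (1 / real (Suc m))"
          using G(3) by (simp add: B_def)
        then have "dist (G d m n x) y < e"
          using d(2) m unfolding mem_ball mem_cball by metric
        moreover obtain i where "from_nat_into I i = (d, m, n)"
          using from_nat_into_surj[OF I(1), of "(d, m, n)"] d(1) by (auto simp: I_def)
        ultimately have "dist (g i x) y < e" by (simp add: g_def)
        then show "\<exists>z\<in>range (\<lambda>i. g i x). dist z y < e" by blast
      qed
    qed
  qed
qed

text \<open>The nonnegative functional defining a supporting hyperplane at the average would vanish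
  on every \<open>y i\<close>, hence on all of \<open>K\<close>.\<close>

lemma suminf_dense_in_rel_interior:
  fixes y :: "nat \<Rightarrow> 'a::euclidean_space"
  assumes K: "convex K" "K \<noteq> {}" and y: "\<And>i. y i \<in> closure K" and dense: "K \<subseteq> closure (range y)"
    and sm: "summable (\<lambda>i. (1/2) ^ Suc i *\<^sub>R y i)"
  shows "(\<Sum>i. (1/2) ^ Suc i *\<^sub>R y i) \<in> rel_interior K"
proof -
  define h where "h = (\<Sum>i. (1/2) ^ Suc i *\<^sub>R y i)"
  \<comment> \<open>The weights sum to one, so an affine functional at \<open>h\<close> is the
    weighted mean of its values at the \<open>y i\<close>.\<close>
  have sums: "(\<lambda>i. (1/2) ^ Suc i * (a \<bullet> y i - b)) sums (a \<bullet> h - b)" for a b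
  proof -
    have "(\<lambda>i. (1/2) ^ Suc i *\<^sub>R y i) sums h"
      unfolding h_def by (rule summable_sums[OF sm])
    then have "(\<lambda>i. a \<bullet> ((1/2) ^ Suc i *\<^sub>R y i)) sums (a \<bullet> h)"
      by (rule bounded_linear.sums[OF bounded_linear_inner_right])
    moreover have "(\<lambda>i. (1/2) ^ Suc i * b) sums (1 * b)"
      by (intro sums_mult2 power_half_series)
    ultimately have "(\<lambda>i. a \<bullet> ((1/2) ^ Suc i *\<^sub>R y i) - (1/2) ^ Suc i * b) sums (a \<bullet> h - 1 * b)"
      by (rule sums_diff)
    then show ?thesis by (simp add: right_diff_distrib)
  qed
  \<comment> \<open>The supporting hyperplane below is available only at a point of the closure.
    Outside it, a separating functional would have a mean below all its values.\<close>
  have "h \<in> closure K"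
  proof (rule ccontr)
    assume "h \<notin> closure K"
    then obtain a b where ab: "a \<bullet> h < b" "\<And>x. x \<in> closure K \<Longrightarrow> b < a \<bullet> x"
      using separating_hyperplane_closed_point[of "closure K" h] K convex_closure by (metis closed_closure)
    have "0 \<le> a \<bullet> h - b"
      by (rule sums_le[OF _ sums_zero sums]) (use ab(2) y in \<open>auto intro!: mult_nonneg_nonneg less_imp_le\<close>)
    then show False using ab by simp
  qed
  moreover have "h \<in> rel_interior K" if h: "h \<in> closure K"
  proof (rule ccontr)
    assume "h \<notin> rel_interior K"
    then obtain a where a: "\<And>z. z \<in> closure K \<Longrightarrow> a \<bullet> h \<le> a \<bullet> z"
      "\<And>z. z \<in> rel_interior K \<Longrightarrow> a \<bullet> h < a \<bullet> z"
      using supporting_hyperplane_relative_frontier[OF K(1) h] by metis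
    have "(\<lambda>i. (1/2) ^ Suc i * (a \<bullet> y i - a \<bullet> h)) sums 0"
      using sums[of a "a \<bullet> h"] by simp
    moreover have "0 \<le> (1/2) ^ Suc i * (a \<bullet> y i - a \<bullet> h)" for i
      using a(1)[OF y, of i] by simp
    ultimately have "\<forall>i. (1/2) ^ Suc i * (a \<bullet> y i - a \<bullet> h) = 0"
      by (subst suminf_eq_zero_iff[symmetric]) (simp_all only: sums_iff)
    then have "range y \<subseteq> {z. a \<bullet> z = a \<bullet> h}"
      by auto
    then have "closure (range y) \<subseteq> {z. a \<bullet> z = a \<bullet> h}"
      by (rule closure_minimal) (rule closed_hyperplane)
    moreover obtain w where w: "w \<in> rel_interior K"
      using K rel_interior_eq_empty by blast
    moreover have "w \<in> closure (range y)"
      using w rel_interior_subset dense by blast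
    \<comment> \<open>The functional is constant on the closure of the \<open>y i\<close>, yet
      strictly larger at the relative interior point \<open>w\<close> than at
      \<open>h\<close>.\<close>
    ultimately show False
      using a(2)[OF w] by auto
  qed
  ultimately show ?thesis unfolding h_def by blast
qed

text \<open>The weighted mean of a dense family of selections lies in the relative interior, and
  thus in the value itself rather than only in its closure. Boundedness makes the series converge
  uniformly, so the mean is continuous.\<close>

theorem continuous_selection_rel_interior:
  fixes \<Phi> :: "'a::{metric_space,second_countable_topology} \<Rightarrow> 'b::euclidean_space set"
  assumes lsc: "lower_semicontinuous_map (top_of_set S) euclidean \<Phi>"
    and ne: "\<And>x. x \<in> S \<Longrightarrow> \<Phi> x \<noteq> {}" and conv: "\<And>x. x \<in> S \<Longrightarrow> convex (\<Phi> x)"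
    and bdd: "bounded (\<Union>x\<in>S. \<Phi> x)"
  obtains h where "continuous_on S h" "\<And>x. x \<in> S \<Longrightarrow> h x \<in> rel_interior (\<Phi> x)"
proof -
  have "\<exists>g :: nat \<Rightarrow> 'a \<Rightarrow> 'b. (\<forall>i. continuous_on S (g i)) \<and>
      (\<forall>x\<in>S. (\<forall>i. g i x \<in> closure (\<Phi> x)) \<and> \<Phi> x \<subseteq> closure (range (\<lambda>i. g i x)))"
    by (rule dense_continuous_selections[OF lsc ne conv])
  then obtain g :: "nat \<Rightarrow> 'a \<Rightarrow> 'b" where g: "\<forall>i. continuous_on S (g i)"
    "\<forall>x\<in>S. (\<forall>i. g i x \<in> closure (\<Phi> x)) \<and> \<Phi> x \<subseteq> closure (range (\<lambda>i. g i x))"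
    by blast
  have cont: "continuous_on S (g i)" for i
    using g(1) by blast
  have cl: "g i x \<in> closure (\<Phi> x)" and dense: "\<Phi> x \<subseteq> closure (range (\<lambda>i. g i x))"
    if "x \<in> S" for i x
    using g(2) that by blast+
  obtain M where M: "(\<Union>x\<in>S. \<Phi> x) \<subseteq> cball 0 M"
    using bdd unfolding bounded_iff by (auto simp: subset_iff)
  have bound: "norm ((1/2) ^ Suc i *\<^sub>R g i x) \<le> (1/2) ^ Suc i * M" if "x \<in> S" for i x
  proof -
    have "closure (\<Phi> x) \<subseteq> cball 0 M"
      using M that by (intro closure_minimal) auto
    then have "norm (g i x) \<le> M" using cl[OF that, of i] by auto
    then show ?thesis by simp
  qed
  have sm: "summable (\<lambda>i. (1/2) ^ Suc i * M)"
    by (intro summable_mult2 sums_summable[OF power_half_series])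
  define h where "h x = (\<Sum>i. (1/2) ^ Suc i *\<^sub>R g i x)" for x
  show thesis
  proof
    have "uniform_limit S (\<lambda>n x. \<Sum>i<n. (1/2) ^ Suc i *\<^sub>R g i x) h sequentially"
      unfolding h_def by (rule Weierstrass_m_test[OF bound sm])
    then show "continuous_on S h"
      by (rule uniform_limit_theorem[rotated]) (auto intro!: always_eventually continuous_intros cont)
    show "h x \<in> rel_interior (\<Phi> x)" if "x \<in> S" for x
      unfolding h_def using that conv ne cl dense
      by (intro suminf_dense_in_rel_interior summable_comparison_test'[OF sm bound]) auto
  qed
qed

section \<open>Fixed points of lower semicontinuous maps\<close>

corollary lower_semicontinuous_map_fixed_point:
  fixes \<Phi> :: "'a::euclidean_space \<Rightarrow> 'a set"
  assumes C: "compact C" "convex C" "C \<noteq> {}"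
    and lsc: "lower_semicontinuous_map (top_of_set C) (top_of_set C) \<Phi>"
    and ne: "\<And>x. x \<in> C \<Longrightarrow> \<Phi> x \<noteq> {}" and conv: "\<And>x. x \<in> C \<Longrightarrow> convex (\<Phi> x)"
    and sub: "\<And>x. x \<in> C \<Longrightarrow> \<Phi> x \<subseteq> C"
  obtains x where "x \<in> C" "x \<in> \<Phi> x"
proof -
  \<comment> \<open>Since the values lie in \<open>C\<close>, they meet \<open>T\<close> exactly
    when they meet \<open>C \<inter> T\<close>; the codomain may thus be taken to be the whole
    space.\<close>
  have "openin (top_of_set C) {x \<in> C. \<Phi> x \<inter> T \<noteq> {}}" if "open T" for T
  proof -
    have "openin (top_of_set C) {x \<in> topspace (top_of_set C). \<Phi> x \<inter> (C \<inter> T) \<noteq> {}}"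
      using lsc that unfolding lower_semicontinuous_map_iff_openin by (meson openin_open_Int)
    moreover have "{x \<in> topspace (top_of_set C). \<Phi> x \<inter> (C \<inter> T) \<noteq> {}} = {x \<in> C. \<Phi> x \<inter> T \<noteq> {}}"
      using sub by auto
    ultimately show ?thesis by simp
  qed
  then have "lower_semicontinuous_map (top_of_set C) euclidean \<Phi>"
    by (simp add: lower_semicontinuous_map_iff_openin)
  moreover have "bounded (\<Union>x\<in>C. \<Phi> x)"
    using sub by (intro bounded_subset[OF compact_imp_bounded[OF C(1)]]) auto
  ultimately obtain h where h: "continuous_on C h" "\<And>x. x \<in> C \<Longrightarrow> h x \<in> rel_interior (\<Phi> x)"
    using continuous_selection_rel_interior[of C \<Phi>] ne conv by blast
  have h\<Phi>: "h x \<in> \<Phi> x" if "x \<in> C" for x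
    using h(2)[OF that] rel_interior_subset by blast
  then have "h \<in> C \<rightarrow> C" using sub by blast
  then obtain x where "x \<in> C" "h x = x"
    using brouwer[OF C h(1)] by blast
  then show thesis using h\<Phi>[of x] that by simp
qed

section \<open>The quasiequilibrium problem\<close>

theorem mainTheorem2:
  fixes C :: "(real ^ 'n) set"
    and f :: "real ^ 'n \<Rightarrow> real ^ 'n \<Rightarrow> real"
    and K :: "real ^ 'n \<Rightarrow> (real ^ 'n) set"
  assumes "C \<noteq> {}" and "convex C" and "compact C"
    and "\<And>x. x \<in> C \<Longrightarrow> f x x = 0"
    and "\<And>x. x \<in> C \<Longrightarrow> K x \<subseteq> C"
    and "lower_semicontinuous_map (top_of_set C) (top_of_set C) K"
    and "\<And>x. x \<in> C \<Longrightarrow> K x \<noteq> {}"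
    and "\<And>x. x \<in> C \<Longrightarrow> convex (K x)"
    and "closed (fixed_set C K)"
    and "\<And>x. x \<in> fixed_set C K \<Longrightarrow> convex (strict_sublevel C f x)"
    and "lower_semicontinuous_map_on (top_of_set C) (top_of_set C)
           (fixed_set C K) (strict_sublevel C f)"
    and "lower_semicontinuous_map_on (top_of_set C) (top_of_set C)
           (top_of_set C frontier_of fixed_set C K) (\<lambda>x. strict_sublevel C f x \<inter> K x)"
  shows "(\<exists>x. quasiequilibrium_solution C f K x \<and>
            x \<in> (top_of_set C frontier_of fixed_set C K) \<union>
                 {x \<in> top_of_set C interior_of fixed_set C K. \<forall>y\<in>C. f x y \<ge> 0})
       \<and> ((\<nexists>x. x \<in> C \<and> (\<forall>y\<in>C. f x y \<ge> 0)) \<longrightarrow>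
            (\<exists>x. quasiequilibrium_solution C f K x \<and>
                 x \<in> top_of_set C frontier_of fixed_set C K))"
proof -
  let ?X = "top_of_set C"
  define F where "F = strict_sublevel C f"
  define A where "A = fixed_set C K"
  define B where "B = ?X frontier_of A"
  have AC: "A \<subseteq> C" and AK: "\<And>x. x \<in> A \<Longrightarrow> x \<in> K x"
    by (auto simp: A_def fixed_set_def)
  have clA: "closedin ?X A"
    using assms(9) AC by (simp add: A_def closed_subset)
  have BA: "B = A - ?X interior_of A"
    using clA by (simp add: B_def frontier_of_def closure_of_closedin)
  have FC: "F x \<subseteq> C" and F_irrefl: "x \<in> C \<Longrightarrow> x \<notin> F x" for x
    using assms(4) by (auto simp: F_def strict_sublevel_def)
  have sol: "\<exists>x. quasiequilibrium_solution C f K x \<and>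
      x \<in> B \<union> {x \<in> ?X interior_of A. \<forall>y\<in>C. f x y \<ge> 0}"
  proof (rule ccontr)
    assume no_sol: "\<not> ?thesis"
    \<comment> \<open>Gluing is done twice: \<open>F \<inter> K\<close> on \<open>B\<close> into
      \<open>F\<close> on \<open>A\<close>, then the result \<open>H\<close> on \<open>A\<close>
      into \<open>K\<close> on \<open>C\<close>. The second gluing needs
      \<open>H x \<subseteq> K x\<close> on \<open>B\<close>, the frontier of \<open>A\<close>;
      hence the intersection with \<open>K\<close> there.\<close>
    define H where "H x = (if x \<in> B then F x \<inter> K x else F x)" for x
    define \<Phi> where "\<Phi> x = (if x \<in> A then H x else K x)" for x
    have lscH: "lower_semicontinuous_map (subtopology ?X A) ?X H"
      unfolding H_def
    proof (rule lower_semicontinuous_map_glue)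
      show "closedin (subtopology ?X A) B"
        unfolding B_def using BA by (intro closedin_subset_topspace closedin_frontier_of) (auto simp: B_def)
      have "subtopology (subtopology ?X A) B = subtopology ?X B"
        using BA by (metis Diff_subset inf.absorb2 subtopology_subtopology)
      then show "lower_semicontinuous_map (subtopology (subtopology ?X A) B) ?X (\<lambda>x. F x \<inter> K x)"
        using assms(12) by (simp add: lower_semicontinuous_map_on_def F_def A_def B_def)
      show "lower_semicontinuous_map (subtopology ?X A) ?X F"
        using assms(11) by (simp add: lower_semicontinuous_map_on_def F_def A_def)
    qed auto
    have lsc\<Phi>: "lower_semicontinuous_map ?X ?X \<Phi>"
      unfolding \<Phi>_def
      by (rule lower_semicontinuous_map_glue[OF clA assms(6) lscH]) (simp add: H_def flip: B_def)
    have ne: "\<Phi> x \<noteq> {}" if x: "x \<in> C" for x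
    proof (cases "x \<in> A")
      case True
      then have "x \<in> K x" using AK by blast
      show ?thesis
      proof (cases "x \<in> B")
        case xB: True
        \<comment> \<open>A point of \<open>B\<close> lies in its own \<open>K x\<close>, so failing
          to be a solution means that \<open>F x\<close> meets \<open>K x\<close>.\<close>
        then have "\<not> (\<forall>y\<in>K x. f x y \<ge> 0)"
          using no_sol x \<open>x \<in> K x\<close> unfolding quasiequilibrium_solution_def by blast
        then show ?thesis
          using xB True assms(5)[OF x] by (force simp: \<Phi>_def H_def F_def strict_sublevel_def)
      next
        case xB: False
        \<comment> \<open>In the interior, nonnegativity on all of \<open>C\<close> would make
          \<open>x\<close> a solution in the required set, because
          \<open>K x \<subseteq> C\<close>.\<close>
        then have "\<not> (\<forall>y\<in>C. f x y \<ge> 0)"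
          using no_sol x \<open>x \<in> K x\<close> True BA assms(5)[OF x] unfolding quasiequilibrium_solution_def by blast
        then show ?thesis
          using xB True by (force simp: \<Phi>_def H_def F_def strict_sublevel_def)
      qed
    qed (use assms(7)[OF x] in \<open>simp add: \<Phi>_def\<close>)
    have conv: "convex (\<Phi> x)" if "x \<in> C" for x
      using that assms(8,10) by (auto simp: \<Phi>_def H_def F_def A_def convex_Int)
    have sub: "\<Phi> x \<subseteq> C" if "x \<in> C" for x
      using that assms(5) FC by (auto simp: \<Phi>_def H_def split: if_splits)
    obtain x where "x \<in> C" "x \<in> \<Phi> x"
      by (rule lower_semicontinuous_map_fixed_point[OF assms(3,2,1) lsc\<Phi> ne conv sub])
    \<comment> \<open>Outside \<open>A\<close> the value is \<open>K x\<close>, and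
      \<open>x \<in> K x\<close> would put \<open>x\<close> into \<open>A\<close>. On
      \<open>A\<close> the value lies in \<open>F x\<close>, which omits \<open>x\<close> because
      \<open>f x x = 0\<close>.\<close>
    then have "x \<in> A"
      by (cases "x \<in> A") (simp_all add: \<Phi>_def A_def fixed_set_def)
    then have "\<Phi> x \<subseteq> F x"
      by (simp add: \<Phi>_def H_def)
    then show False
      using F_irrefl \<open>x \<in> C\<close> \<open>x \<in> \<Phi> x\<close> by blast
  qed
  moreover have "?X interior_of A \<subseteq> C"
    using interior_of_subset[of ?X A] AC by (rule order_trans)
  \<comment> \<open>With no point of \<open>C\<close> nonnegative against all of \<open>C\<close>,
    the interior part of the set is empty and only \<open>B\<close> remains.\<close>
  ultimately have "\<exists>x. quasiequilibrium_solution C f K x \<and> x \<in> B"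
    if "\<nexists>x. x \<in> C \<and> (\<forall>y\<in>C. f x y \<ge> 0)"
    using that by blast
  then show ?thesis
    using sol unfolding A_def B_def by (intro conjI impI)
qed

end
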